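(* Suppose that assumptions (a), (b), (c) of the context hold, that the existence-constrained semi-infinite program (E) of the context is feasible, and that every master subproblem $(\mathrm M_{\mathbb Q})$ and every separation subproblem $(\mathrm S_i(z))$ encountered by the algorithm of the context is solved to (global) optimality. Then the algorithm either terminates with a solution (global minimizer) $z^*$ of (E), or generates a sequence of master solutions $z_m^*$ whose accumulation points are all optimal for (E).
   Context: Notation: $[n]=\{1,\dots,n\}$; vector inequalities are componentwise; $\Lambda_{n_h+1}=\{\lambda\in\mathbb R^{n_h+1}:\sum_{j=1}^{n_h+1}\lambda_j=1,\ \lambda_j\ge0\}$. Data: $\mathcal Z\subseteq\mathbb R^{n_z}$, $\bar{\mathcal V}\subset\mathbb R^{n_v}$ bounded, $f:\mathcal Z\to\mathbb R$, $g:\mathcal Z\times\bar{\mathcal V}\to\mathbb R^{n_g}$, $h:\mathcal Z\times\bar{\mathcal V}\to\mathbb R^{n_h}$, $r:\mathcal Z\times\bar{\mathcal V}\to\mathbb R^{n_r}$, and $\mathcal V(z)=\{v\in\bar{\mathcal V}: h(z,v)\ge0,\ r(z,v)=0\}$. Assumptions: (a) Compactness: $\mathcal Z$ and $\mathcal V(z)$ are non-empty, compact, and uniformly bounded for all $z\in\mathcal Z$. (b) Determined part: there is a partition $v=(p,q)$ with $p\in\mathbb R^{n_r}$, $q\in\bar{\mathcal Q}\subset\mathbb R^{n_v-n_r}$, $\bar{\mathcal Q}$ compact, such that, with $Q(z)=\{q:\exists p,\ (p,q)\in\mathcal V(z)\}$, for every $z\in\mathcal Z$: (i) for each $q\in\bar{\mathcal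 Q}$, $r(z,(p,q))=0$ has a unique solution $p$, continuous in $(z,q)$; (ii) $Q(z)\subseteq\bar{\mathcal Q}$; (iii) every $(p,q)$ with $r(z,(p,q))=0$ and $q\in\bar{\mathcal Q}$ (including those where $h\not\ge0$) lies in $\operatorname{int}(\bar{\mathcal V})$. (c) Smoothness: $f,g,h,r\in\mathcal C^\rho$ for some $\rho\in\{0,1,\dots,+\infty\}$ ($\rho$-times differentiable for $\rho\ge1$, continuous for $\rho=0$). Existence-constrained program (E): $$\min_{z\in\mathcal Z} f(z)\ \text{ s.t. }\ \forall q\in\bar{\mathcal Q},\ v=(p,q)\text{ with } r(z,(p,q))=0,\ \forall i\in[n_g],\ \exists\lambda_i\in\Lambda_{n_h+1}:\ \lambda_{i,1}g_i(z,v)+\sum_{j=1}^{n_h}\lambda_{i,j+1}h_j(z,v)\le0.$$ Master subproblem $(\mathrm M_{\mathbb Q})$ for a finite set $\mathbb Q=\{q_1,\dots,q_M\}\subseteq\bar{\mathcal Q}$: minimize $f(z)$ over $z\in\mathcal Z$, $\{p_m\}_{m\in[M]}$, $\{\lambda_{i,m}\}_{i\in[n_g],m\in[M]}$ subject to, for all $m\in[M]$, $i\in[n_g]$: $v_m=(p_m,q_m)$, $\lambda_{i,m}\in\Lambda_{n_h+1}$, $r(z,v_m)=0$, and $\lambda_{i,m,1}g_i(z,v_m)+\sum_{j=1}^{n_h}\lambda_{i,m,j+1}h_j(z,v_m)\le0$. Separation subproblem $(\mathrm S_i(z))$ for $z\in\mathcal Z$, $i\in[n_g]$: maximize $s$ over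 $q\in\bar{\mathcal Q}$, $p$, $s\in\mathbb R$ subject to $v=(p,q)$, $r(z,v)=0$, $s\le g_i(z,v)$, and $s\le h_j(z,v)$ for all $j\in[n_h]$. A solution is denoted $(q_i^*,p_i^*,s_i^* )$. Algorithm: input a nonempty finite $\mathbb Q_0\subseteq\bar{\mathcal Q}$; set $\mathbb Q\leftarrow\mathbb Q_0$, $m\leftarrow\mathrm{card}(\mathbb Q_0)$. Repeat: (1) solve $(\mathrm M_{\mathbb Q})$ for a minimizer with $z$-component $z_m^*$; (2) $m\leftarrow m+1$; (3) for each $i\in[n_g]$ solve $(\mathrm S_i(z_{m-1}^* ))$ to obtain $(q_i^*,p_i^*,s_i^* )$; (4) select $i^*\in\arg\max_{i\in[n_g]}s_i^*$ and set $(q_m,s_m)\leftarrow(q_{i^*}^*,s_{i^*}^* )$; (5) if $s_m\le0$, stop and return $z^*=z_{m-1}^*$; (6) otherwise set $\mathbb Q\leftarrow\mathbb Q\cup\{q_m\}$ and continue. *)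

theory Defs
  imports "HOL-Analysis.Analysis" "HOL-Library.Extended_Nat"
begin

text \<open>
  Functions are given only on \<open>Z\<close> and \<open>Z \<times> Vbar\<close>; values of the total HOL functions elsewhere are
  irrelevant, and every definition below restricts its points to these domains accordingly.
  Components are indexed by \<open>{1..ng}\<close>, \<open>{1..nh}\<close>, \<open>{1..nr}\<close>, so that \<open>nh = 0\<close> and \<open>nr = 0\<close> are allowed.

  The partition \<open>v = (p, q)\<close> is given by the set \<open>pidx\<close> of the coordinates of \<open>v\<close> that belong to \<open>p\<close>.
  Both \<open>p\<close> and \<open>q\<close> are kept as vectors in the space of \<open>v\<close>, padded by zeros on the coordinates of
  the other part, so that \<open>(p, q)\<close> is \<open>p + q\<close>.
\<close>

record ('z, 'v) problem =
  Zset :: "(real ^ 'z) set"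
  Vbar :: "(real ^ 'v) set"
  ng :: nat
  nh :: nat
  nr :: nat
  fobj :: "real ^ 'z \<Rightarrow> real"
  gfun :: "nat \<Rightarrow> (real ^ 'z) \<times> (real ^ 'v) \<Rightarrow> real"
  hfun :: "nat \<Rightarrow> (real ^ 'z) \<times> (real ^ 'v) \<Rightarrow> real"
  rfun :: "nat \<Rightarrow> (real ^ 'z) \<times> (real ^ 'v) \<Rightarrow> real"
  pidx :: "'v set"
  Qbar :: "(real ^ 'v) set"

definition coord_space :: "'n set \<Rightarrow> (real ^ 'n::finite) set" where
  "coord_space I = {x. \<forall>i. i \<notin> I \<longrightarrow> x $ i = 0}"

abbreviation pspace :: "('z::finite, 'v::finite) problem \<Rightarrow> (real ^ 'v) set" where
  "pspace D \<equiv> coord_space (pidx D)"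

abbreviation qspace :: "('z::finite, 'v::finite) problem \<Rightarrow> (real ^ 'v) set" where
  "qspace D \<equiv> coord_space (- pidx D)"

definition r_zero :: "('z::finite, 'v::finite) problem \<Rightarrow> real ^ 'z \<Rightarrow> real ^ 'v \<Rightarrow> bool" where
  "r_zero D z v \<longleftrightarrow> v \<in> Vbar D \<and> (\<forall>k\<in>{1..nr D}. rfun D k (z, v) = 0)"

definition Vset :: "('z::finite, 'v::finite) problem \<Rightarrow> real ^ 'z \<Rightarrow> (real ^ 'v) set" where
  "Vset D z = {v \<in> Vbar D. (\<forall>j\<in>{1..nh D}. hfun D j (z, v) \<ge> 0) \<and> r_zero D z v}"

definition Qset :: "('z::finite, 'v::finite) problem \<Rightarrow> real ^ 'z \<Rightarrow> (real ^ 'v) set" where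
  "Qset D z = {q \<in> qspace D. \<exists>p\<in>pspace D. p + q \<in> Vset D z}"


definition compactness :: "('z::finite, 'v::finite) problem \<Rightarrow> bool" where
  "compactness D \<longleftrightarrow>
     Zset D \<noteq> {} \<and> compact (Zset D) \<and>
     (\<forall>z\<in>Zset D. Vset D z \<noteq> {} \<and> compact (Vset D z)) \<and>
     bounded (\<Union>z\<in>Zset D. Vset D z)"

definition determined_part :: "('z::finite, 'v::finite) problem \<Rightarrow> bool" where
  "determined_part D \<longleftrightarrow>
     card (pidx D) = nr D \<and> Qbar D \<subseteq> qspace D \<and> compact (Qbar D) \<and>
     (\<forall>z\<in>Zset D. \<forall>q\<in>Qbar D. \<exists>!p. p \<in> pspace D \<and> r_zero D z (p + q)) \<and>
     continuous_on (Zset D \<times> Qbar D) (\<lambda>(z, q). THE p. p \<in> pspace D \<and> r_zero D z (p + q)) \<and>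
     (\<forall>z\<in>Zset D. Qset D z \<subseteq> Qbar D) \<and>
     (\<forall>z\<in>Zset D. \<forall>q\<in>Qbar D. \<forall>p\<in>pspace D. r_zero D z (p + q) \<longrightarrow> p + q \<in> interior (Vbar D))"

text \<open>
  The sets \<open>Z\<close> and \<open>Z \<times> Vbar\<close> need not be open, so differentiability is understood relative to the set;
  this is implied by differentiability of an extension to an open neighbourhood. Continuity of the
  highest derivatives is not required.
\<close>

primrec times_differentiable_on :: "nat \<Rightarrow> 'a::euclidean_space set \<Rightarrow> ('a \<Rightarrow> real) \<Rightarrow> bool" where
  "times_differentiable_on 0 S F \<longleftrightarrow> True"
| "times_differentiable_on (Suc n) S F \<longleftrightarrow>
     (\<exists>G. (\<forall>x\<in>S. (F has_derivative (\<lambda>h. G x \<bullet> h)) (at x within S)) \<and>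
          (\<forall>b\<in>Basis. times_differentiable_on n S (\<lambda>x. G x \<bullet> b)))"

definition C_class :: "enat \<Rightarrow> 'a::euclidean_space set \<Rightarrow> ('a \<Rightarrow> real) \<Rightarrow> bool" where
  "C_class \<rho> S F \<longleftrightarrow>
     (if \<rho> = 0 then continuous_on S F
      else \<forall>n. enat n \<le> \<rho> \<longrightarrow> times_differentiable_on n S F)"

definition smoothness :: "enat \<Rightarrow> ('z::finite, 'v::finite) problem \<Rightarrow> bool" where
  "smoothness \<rho> D \<longleftrightarrow>
     C_class \<rho> (Zset D) (fobj D) \<and>
     (\<forall>i\<in>{1..ng D}. C_class \<rho> (Zset D \<times> Vbar D) (gfun D i)) \<and>
     (\<forall>j\<in>{1..nh D}. C_class \<rho> (Zset D \<times> Vbar D) (hfun D j)) \<and>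
     (\<forall>k\<in>{1..nr D}. C_class \<rho> (Zset D \<times> Vbar D) (rfun D k))"


definition unit_simplex :: "nat \<Rightarrow> (nat \<Rightarrow> real) set" where
  "unit_simplex n = {l. (\<Sum>j=1..n. l j) = 1 \<and> (\<forall>j\<in>{1..n}. l j \<ge> 0)}"

definition multiplier_constraint ::
  "('z::finite, 'v::finite) problem \<Rightarrow> nat \<Rightarrow> (nat \<Rightarrow> real) \<Rightarrow> real ^ 'z \<Rightarrow> real ^ 'v \<Rightarrow> bool" where
  "multiplier_constraint D i l z v \<longleftrightarrow>
     l 1 * gfun D i (z, v) + (\<Sum>j=1..nh D. l (j + 1) * hfun D j (z, v)) \<le> 0"

definition E_feasible :: "('z::finite, 'v::finite) problem \<Rightarrow> real ^ 'z \<Rightarrow> bool" where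
  "E_feasible D z \<longleftrightarrow> z \<in> Zset D \<and>
     (\<forall>q\<in>Qbar D. \<forall>p\<in>pspace D. r_zero D z (p + q) \<longrightarrow>
        (\<forall>i\<in>{1..ng D}. \<exists>l\<in>unit_simplex (nh D + 1). multiplier_constraint D i l z (p + q)))"

definition E_solution :: "('z::finite, 'v::finite) problem \<Rightarrow> real ^ 'z \<Rightarrow> bool" where
  "E_solution D z \<longleftrightarrow> is_arg_min (fobj D) (E_feasible D) z"

text \<open>
  In the master subproblem the copies \<open>p\<close> and the multipliers are indexed by the elements \<open>q\<close> of the
  finite set \<open>Q\<close> itself.
\<close>

type_synonym ('z, 'v) master_point =
  "(real ^ 'z) \<times> (real ^ 'v \<Rightarrow> real ^ 'v) \<times> (nat \<Rightarrow> real ^ 'v \<Rightarrow> nat \<Rightarrow> real)"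

definition master_feasible ::
  "('z::finite, 'v::finite) problem \<Rightarrow> (real ^ 'v) set \<Rightarrow> ('z, 'v) master_point \<Rightarrow> bool" where
  "master_feasible D Q = (\<lambda>(z, p, l). z \<in> Zset D \<and>
     (\<forall>q\<in>Q. p q \<in> pspace D \<and> r_zero D z (p q + q) \<and>
        (\<forall>i\<in>{1..ng D}. l i q \<in> unit_simplex (nh D + 1) \<and>
                       multiplier_constraint D i (l i q) z (p q + q))))"

definition master_solution ::
  "('z::finite, 'v::finite) problem \<Rightarrow> (real ^ 'v) set \<Rightarrow> ('z, 'v) master_point \<Rightarrow> bool" where
  "master_solution D Q x \<longleftrightarrow> is_arg_min (\<lambda>(z, p, l). fobj D z) (master_feasible D Q) x"

text \<open>Points of the separation subproblem are triples \<open>(q, p, s)\<close>.\<close>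

type_synonym 'v separation_point = "(real ^ 'v) \<times> (real ^ 'v) \<times> real"

definition separation_feasible ::
  "('z::finite, 'v::finite) problem \<Rightarrow> nat \<Rightarrow> real ^ 'z \<Rightarrow> 'v separation_point \<Rightarrow> bool" where
  "separation_feasible D i z = (\<lambda>(q, p, s). q \<in> Qbar D \<and> p \<in> pspace D \<and> r_zero D z (p + q) \<and>
     s \<le> gfun D i (z, p + q) \<and> (\<forall>j\<in>{1..nh D}. s \<le> hfun D j (z, p + q)))"

definition separation_solution ::
  "('z::finite, 'v::finite) problem \<Rightarrow> nat \<Rightarrow> real ^ 'z \<Rightarrow> 'v separation_point \<Rightarrow> bool" where
  "separation_solution D i z x \<longleftrightarrow>
     is_arg_max (\<lambda>(q, p, s). s) (separation_feasible D i z) x"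


text \<open>
  The algorithm is run with arbitrary subproblem solvers and an arbitrary selection of the index
  \<open>i*\<close>. They take the counter \<open>m\<close> (its value at the start of the pass) as an additional argument, so
  that a subproblem met twice may be answered differently. That the answers are optimal is a
  property of a run, \<open>solved_to_optimality\<close>.
\<close>

record ('z, 'v) solvers =
  master :: "nat \<Rightarrow> (real ^ 'v) set \<Rightarrow> ('z, 'v) master_point"
  separation :: "nat \<Rightarrow> nat \<Rightarrow> real ^ 'z \<Rightarrow> 'v separation_point"
  selection :: "nat \<Rightarrow> nat"

datatype ('z, 'v) state = Running nat "(real ^ 'v) set" | Stopped "real ^ 'z"

definition master_z ::
  "('z::finite, 'v::finite) solvers \<Rightarrow> nat \<Rightarrow> (real ^ 'v) set \<Rightarrow> real ^ 'z" where
  "master_z A m Q = fst (master A m Q)"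

primrec step :: "('z::finite, 'v::finite) solvers \<Rightarrow> ('z, 'v) state \<Rightarrow> ('z, 'v) state" where
  "step A (Running m Q) =
     (let z = master_z A m Q;
          (q, p, s) = separation A m (selection A m) z
      in if s \<le> 0 then Stopped z else Running (m + 1) (Q \<union> {q}))"
| "step A (Stopped z) = Stopped z"

definition run ::
  "('z::finite, 'v::finite) solvers \<Rightarrow> (real ^ 'v) set \<Rightarrow> nat \<Rightarrow> ('z, 'v) state" where
  "run A Q0 k = (step A ^^ k) (Running (card Q0) Q0)"

definition solved_to_optimality ::
  "('z::finite, 'v::finite) problem \<Rightarrow> ('z, 'v) solvers \<Rightarrow> (real ^ 'v) set \<Rightarrow> bool" where
  "solved_to_optimality D A Q0 \<longleftrightarrow>
     (\<forall>k m Q. run A Q0 k = Running m Q \<longrightarrow>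
        master_solution D Q (master A m Q) \<and>
        (\<forall>i\<in>{1..ng D}. separation_solution D i (master_z A m Q) (separation A m i (master_z A m Q))))"

definition selects_maximal ::
  "('z::finite, 'v::finite) problem \<Rightarrow> ('z, 'v) solvers \<Rightarrow> (real ^ 'v) set \<Rightarrow> bool" where
  "selects_maximal D A Q0 \<longleftrightarrow>
     (\<forall>k m Q. run A Q0 k = Running m Q \<longrightarrow>
        is_arg_max (\<lambda>i. snd (snd (separation A m i (master_z A m Q)))) (\<lambda>i. i \<in> {1..ng D})
          (selection A m))"

definition terminates_with ::
  "('z::finite, 'v::finite) solvers \<Rightarrow> (real ^ 'v) set \<Rightarrow> real ^ 'z \<Rightarrow> bool" where
  "terminates_with A Q0 z \<longleftrightarrow> (\<exists>k. run A Q0 k = Stopped z)"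

text \<open>The sequence starts with the first master solution, i.e. its \<open>k\<close>-th term has counter \<open>card Q0 + k\<close>.\<close>

definition generates_sequence ::
  "('z::finite, 'v::finite) solvers \<Rightarrow> (real ^ 'v) set \<Rightarrow> (nat \<Rightarrow> real ^ 'z) \<Rightarrow> bool" where
  "generates_sequence A Q0 zs \<longleftrightarrow>
     (\<forall>k. \<exists>m Q. run A Q0 k = Running m Q \<and> zs k = master_z A m Q)"

definition accumulation_point :: "(nat \<Rightarrow> 'a::topological_space) \<Rightarrow> 'a \<Rightarrow> bool" where
  "accumulation_point X x \<longleftrightarrow> (\<exists>\<phi>::nat \<Rightarrow> nat. strict_mono \<phi> \<and> (X \<circ> \<phi>) \<longlonglongrightarrow> x)"

end

theory Submission
  imports Defs
begin

text \<open>
  Since \<open>p\<close> is determined by \<open>(z, q)\<close>, feasibility for (E) says that a continuous function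
  \<open>\<Phi> (z, q) = max\<^sub>i min {g\<^sub>i, h\<^sub>1, \<dots>}\<close> on the compact set \<open>Z \<times> Qbar\<close> satisfies \<open>\<Phi> (z, q) \<le> 0\<close> for all
  \<open>q\<close>; the master subproblems relax this to finitely many \<open>q\<close>, and the separation step picks a
  maximizer \<open>q\<^sub>k\<close> of \<open>\<Phi> (z\<^sub>k, \<cdot>)\<close>. Let \<open>z\<^sub>k \<longlonglongrightarrow> x\<close> and \<open>q\<^sub>k \<longlonglongrightarrow> q'\<close> along a common subsequence. Then
  \<open>\<Phi> (z\<^sub>l, q\<^sub>k) \<le> 0\<close> for \<open>k < l\<close> gives \<open>\<Phi> (x, q') \<le> 0\<close>, while \<open>\<Phi> (z\<^sub>k, q) \<le> \<Phi> (z\<^sub>k, q\<^sub>k)\<close> gives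
  \<open>\<Phi> (x, q) \<le> \<Phi> (x, q')\<close> for every \<open>q\<close>. So \<open>x\<close> is feasible, and it is optimal because each \<open>z\<^sub>k\<close>
  minimizes \<open>f\<close> over a relaxation.
\<close>

section \<open>Continuity of finite extrema and of functions of class \<open>C_class\<close>\<close>

lemma continuous_on_Max_image:
  fixes F :: "'i \<Rightarrow> 'a::topological_space \<Rightarrow> real"
  assumes "finite I" "I \<noteq> {}" "\<And>i. i \<in> I \<Longrightarrow> continuous_on S (F i)"
  shows "continuous_on S (\<lambda>x. Max ((\<lambda>i. F i x) ` I))"
  using assms by (induction rule: finite_ne_induct) (auto intro!: continuous_on_max)

lemma continuous_on_Min_image:
  fixes F :: "'i \<Rightarrow> 'a::topological_space \<Rightarrow> real"
  assumes "finite I" "I \<noteq> {}" "\<And>i. i \<in> I \<Longrightarrow> continuous_on S (F i)"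
  shows "continuous_on S (\<lambda>x. Min ((\<lambda>i. F i x) ` I))"
  using assms by (induction rule: finite_ne_induct) (auto intro!: continuous_on_min)

lemma C_class_imp_continuous_on:
  assumes "C_class \<rho> S F"
  shows "continuous_on S F"
proof (cases "\<rho> = 0")
  case True
  then show ?thesis using assms by (simp add: C_class_def)
next
  case False
  \<comment> \<open>For nonzero \<rho>, including \<infinity>, one order of differentiability
    already gives continuity.\<close>
  then have "enat (Suc 0) \<le> \<rho>"
    by (metis eSuc_enat ileI1 i0_less zero_enat_def)
  with assms False have "times_differentiable_on (Suc 0) S F"
    unfolding C_class_def by meson
  then obtain G where "\<forall>x\<in>S. (F has_derivative (\<lambda>h. G x \<bullet> h)) (at x within S)"
    by auto
  then show ?thesis
    by (meson continuous_on_eq_continuous_within has_derivative_continuous)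
qed

text \<open>A convex combination is never below the smallest entry, and the vertex of the simplex at
  an entry \<open>a j \<le> 0\<close> attains that entry. The multipliers are numbered from 1 and
  the entries from 0, hence the shifts by one.\<close>

lemma unit_simplex_combination_nonpos_iff:
  "(\<exists>l\<in>unit_simplex (n + 1). l 1 * a 0 + (\<Sum>j=1..n. l (j + 1) * a j) \<le> 0) \<longleftrightarrow>
   Min (a ` {0..n}) \<le> 0"
proof
  assume "\<exists>l\<in>unit_simplex (n + 1). l 1 * a 0 + (\<Sum>j=1..n. l (j + 1) * a j) \<le> 0"
  then obtain l where l: "l \<in> unit_simplex (n + 1)"
    and le: "l 1 * a 0 + (\<Sum>j=1..n. l (j + 1) * a j) \<le> 0" by blast
  let ?m = "Min (a ` {0..n})"
  have shift: "(\<Sum>j=0..n. l (j + 1)) = 1"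
    using l sum.shift_bounds_cl_nat_ivl[of l 0 1 n] by (simp add: unit_simplex_def)
  have "?m = (\<Sum>j=0..n. l (j + 1) * ?m)"
    using shift by (simp flip: sum_distrib_right)
  also have "\<dots> \<le> (\<Sum>j=0..n. l (j + 1) * a j)"
    using l by (intro sum_mono mult_left_mono) (auto simp: unit_simplex_def)
  also have "\<dots> = l 1 * a 0 + (\<Sum>j=1..n. l (j + 1) * a j)"
    by (simp add: sum.atLeast_Suc_atMost)
  finally show "?m \<le> 0" using le by linarith
next
  assume "Min (a ` {0..n}) \<le> 0"
  then obtain j where j: "j \<le> n" "a j \<le> 0"
    by (subst (asm) Min_le_iff) auto
  define l :: "nat \<Rightarrow> real" where "l = (\<lambda>k. if k = j + 1 then 1 else 0)"
  have "l \<in> unit_simplex (n + 1)"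
    using j by (simp add: unit_simplex_def l_def)
  moreover have "l 1 * a 0 + (\<Sum>k=1..n. l (k + 1) * a k) = (\<Sum>k=0..n. l (k + 1) * a k)"
    by (simp add: sum.atLeast_Suc_atMost)
  moreover have "\<dots> = (\<Sum>k=0..n. if k = j then a k else 0)"
    by (intro sum.cong) (auto simp: l_def)
  ultimately show "\<exists>l\<in>unit_simplex (n + 1). l 1 * a 0 + (\<Sum>j=1..n. l (j + 1) * a j) \<le> 0"
    using j by (intro bexI[of _ l]) auto
qed

lemma accumulation_point_cutting_set:
  fixes \<Phi> :: "'a::metric_space \<times> 'b::metric_space \<Rightarrow> real"
  assumes "compact Z" "compact K" and cont: "continuous_on (Z \<times> K) \<Phi>"
    and zs: "\<And>k. zs k \<in> Z" and qs: "\<And>k. qs k \<in> K"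
    and maximal: "\<And>k q. q \<in> K \<Longrightarrow> \<Phi> (zs k, q) \<le> \<Phi> (zs k, qs k)"
    and cut: "\<And>k l. k < l \<Longrightarrow> \<Phi> (zs l, qs k) \<le> 0"
    and x: "accumulation_point zs x" and "q \<in> K"
  shows "\<Phi> (x, q) \<le> 0"
proof -
  obtain \<phi> :: "nat \<Rightarrow> nat" where \<phi>: "strict_mono \<phi>" "(zs \<circ> \<phi>) \<longlonglongrightarrow> x"
    using x by (auto simp: accumulation_point_def)
  \<comment> \<open>The subsequence is refined a second time, so that the cutting points converge
    along the same indices as the iterates.\<close>
  obtain q' \<psi> where q': "q' \<in> K" and \<psi>: "strict_mono (\<psi> :: nat \<Rightarrow> nat)" "(qs \<circ> \<phi> \<circ> \<psi>) \<longlonglongrightarrow> q'"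
    using \<open>compact K\<close> qs unfolding compact_def by (metis comp_apply)
  define \<theta> where "\<theta> = \<phi> \<circ> \<psi>"
  have \<theta>: "strict_mono \<theta>" using \<phi> \<psi> by (simp add: \<theta>_def strict_mono_o)
  have z_lim: "(\<lambda>n. zs (\<theta> n)) \<longlonglongrightarrow> x"
    using LIMSEQ_subseq_LIMSEQ[OF \<phi>(2) \<psi>(1)] by (simp add: \<theta>_def o_def)
  have q_lim: "(\<lambda>n. qs (\<theta> n)) \<longlonglongrightarrow> q'"
    using \<psi>(2) by (simp add: \<theta>_def o_def)
  have "x \<in> Z"
    using compact_imp_closed[OF \<open>compact Z\<close>] z_lim zs by (meson closed_sequentially)
  have \<Phi>_lim: "(\<lambda>n. \<Phi> (u n, w n)) \<longlonglongrightarrow> \<Phi> (x, y)"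
    if "u \<longlonglongrightarrow> x" "w \<longlonglongrightarrow> y" "\<And>n. u n \<in> Z" "\<And>n. w n \<in> K" "y \<in> K" for u w y
    using that \<open>x \<in> Z\<close>
    by (intro continuous_on_tendsto_compose[OF cont] tendsto_Pair always_eventually) auto
  have "\<Phi> (x, q') \<le> 0"
  proof (rule LIMSEQ_le_const2)
    \<comment> \<open>Pairing each cutting point with the next iterate of the subsequence makes
      \<open>cut\<close> applicable, since \<open>\<theta> n < \<theta> (Suc n)\<close>; the shift
      does not change the limit.\<close>
    show "(\<lambda>n. \<Phi> (zs (\<theta> (Suc n)), qs (\<theta> n))) \<longlonglongrightarrow> \<Phi> (x, q')"
      using LIMSEQ_Suc[OF z_lim] q_lim q' by (intro \<Phi>_lim zs qs)
    show "\<exists>N. \<forall>n\<ge>N. \<Phi> (zs (\<theta> (Suc n)), qs (\<theta> n)) \<le> 0"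
      using \<theta> cut by (simp add: strict_mono_Suc_iff)
  qed
  moreover have "\<Phi> (x, q) \<le> \<Phi> (x, q')"
  proof (rule LIMSEQ_le)
    show "(\<lambda>n. \<Phi> (zs (\<theta> n), q)) \<longlonglongrightarrow> \<Phi> (x, q)"
      using z_lim \<open>q \<in> K\<close> by (intro \<Phi>_lim zs) auto
    show "(\<lambda>n. \<Phi> (zs (\<theta> n), qs (\<theta> n))) \<longlonglongrightarrow> \<Phi> (x, q')"
      using z_lim q_lim q' by (intro \<Phi>_lim zs qs)
  qed (use maximal \<open>q \<in> K\<close> in auto)
  ultimately show ?thesis by linarith
qed

section \<open>Reduction of (E) and its subproblems to the sign of a scalar function\<close>

definition p_of :: "('z::finite, 'v::finite) problem \<Rightarrow> real ^ 'z \<Rightarrow> real ^ 'v \<Rightarrow> real ^ 'v" where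
  "p_of D z q = (THE p. p \<in> pspace D \<and> r_zero D z (p + q))"

text \<open>Giving g the index 0 puts g and h into one family over \<open>{0..nh D}\<close>, which
  is nonempty even for \<open>nh D = 0\<close>, so that its \<open>Min\<close> is
  meaningful.\<close>

definition comp_val ::
  "('z::finite, 'v::finite) problem \<Rightarrow> nat \<Rightarrow> nat \<Rightarrow> (real ^ 'z) \<times> (real ^ 'v) \<Rightarrow> real" where
  "comp_val D i j = (if j = 0 then gfun D i else hfun D j)"

definition sep_val ::
  "('z::finite, 'v::finite) problem \<Rightarrow> nat \<Rightarrow> (real ^ 'z) \<times> (real ^ 'v) \<Rightarrow> real" where
  "sep_val D i = (\<lambda>(z, q). Min ((\<lambda>j. comp_val D i j (z, p_of D z q + q)) ` {0..nh D}))"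

text \<open>This is the function \<Phi> of the overview. \<open>Max\<close> of the empty set is
  unspecified, so its sign is interpreted only under \<open>ng D \<ge> 1\<close>.\<close>

definition violation ::
  "('z::finite, 'v::finite) problem \<Rightarrow> (real ^ 'z) \<times> (real ^ 'v) \<Rightarrow> real" where
  "violation D x = Max ((\<lambda>i. sep_val D i x) ` {1..ng D})"

lemma p_of_iff:
  assumes "determined_part D" "z \<in> Zset D" "q \<in> Qbar D"
  shows "p \<in> pspace D \<and> r_zero D z (p + q) \<longleftrightarrow> p = p_of D z q"
proof -
  have ex1: "\<exists>!p. p \<in> pspace D \<and> r_zero D z (p + q)"
    using assms by (simp add: determined_part_def)
  from theI'[OF ex1] ex1 show ?thesis
    unfolding p_of_def by blast
qed

lemma continuous_on_sep_val:
  assumes det: "determined_part D" and smooth: "smoothness \<rho> D" and i: "i \<in> {1..ng D}"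
  shows "continuous_on (Zset D \<times> Qbar D) (sep_val D i)"
proof -
  \<comment> \<open>\<open>p_of\<close> repeats the description whose joint continuity
    \<open>determined_part\<close> asserts.\<close>
  have p: "continuous_on (Zset D \<times> Qbar D) (\<lambda>x. p_of D (fst x) (snd x))"
    using det by (simp add: determined_part_def p_of_def case_prod_unfold)
  have emb: "continuous_on (Zset D \<times> Qbar D) (\<lambda>x. (fst x, p_of D (fst x) (snd x) + snd x))"
    by (intro continuous_intros p)
  \<comment> \<open>Smoothness is given on \<open>Zset D \<times> Vbar D\<close> only; the
    composition stays there because \<open>r_zero\<close> includes membership in
    \<open>Vbar D\<close>.\<close>
  have img: "(\<lambda>x. (fst x, p_of D (fst x) (snd x) + snd x)) ` (Zset D \<times> Qbar D) \<subseteq> Zset D \<times> Vbar D"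
    using p_of_iff[OF det] by (force simp: r_zero_def)
  have comp: "continuous_on (Zset D \<times> Vbar D) (comp_val D i j)" if "j \<in> {0..nh D}" for j
    using smooth i that by (auto simp: comp_val_def smoothness_def intro!: C_class_imp_continuous_on)
  show ?thesis
    unfolding sep_val_def case_prod_unfold
    by (rule continuous_on_Min_image) (auto intro: continuous_on_compose2[OF comp emb img])
qed

lemma ex_multiplier_iff:
  "(\<exists>l\<in>unit_simplex (nh D + 1). multiplier_constraint D i l z (p_of D z q + q)) \<longleftrightarrow>
   sep_val D i (z, q) \<le> 0"
proof -
  let ?a = "\<lambda>j. comp_val D i j (z, p_of D z q + q)"
  have "multiplier_constraint D i l z (p_of D z q + q) \<longleftrightarrow>
        l 1 * ?a 0 + (\<Sum>j=1..nh D. l (j + 1) * ?a j) \<le> 0" for l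
  proof -
    have "(\<Sum>j=1..nh D. l (j + 1) * hfun D j (z, p_of D z q + q)) =
          (\<Sum>j=1..nh D. l (j + 1) * ?a j)"
      by (intro sum.cong) (auto simp: comp_val_def)
    then show ?thesis by (simp only: multiplier_constraint_def) (simp add: comp_val_def)
  qed
  then show ?thesis
    using unit_simplex_combination_nonpos_iff[of "nh D" ?a] by (simp add: sep_val_def)
qed

lemma violation_nonpos_iff:
  assumes "ng D \<ge> 1"
  shows "violation D (z, q) \<le> 0 \<longleftrightarrow> (\<forall>i\<in>{1..ng D}. sep_val D i (z, q) \<le> 0)"
  using assms unfolding violation_def by (subst Max_le_iff) auto

lemma E_feasible_iff:
  assumes det: "determined_part D" and "ng D \<ge> 1"
  shows "E_feasible D z \<longleftrightarrow> z \<in> Zset D \<and> (\<forall>q\<in>Qbar D. violation D (z, q) \<le> 0)"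
proof (cases "z \<in> Zset D")
  case True
  have "E_feasible D z \<longleftrightarrow> (\<forall>q\<in>Qbar D. \<forall>p. p \<in> pspace D \<and> r_zero D z (p + q) \<longrightarrow>
      (\<forall>i\<in>{1..ng D}. \<exists>l\<in>unit_simplex (nh D + 1). multiplier_constraint D i l z (p + q)))"
    using True unfolding E_feasible_def by blast
  also have "\<dots> \<longleftrightarrow> (\<forall>q\<in>Qbar D. \<forall>i\<in>{1..ng D}. sep_val D i (z, q) \<le> 0)"
    by (simp add: p_of_iff[OF det True] ex_multiplier_iff[simplified])
  finally show ?thesis
    using True violation_nonpos_iff[OF \<open>ng D \<ge> 1\<close>] by simp
qed (simp add: E_feasible_def)

text \<open>Uniqueness of p forces each copy \<open>p q\<close> to be \<open>p_of D z q\<close>. The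
  multipliers for different pairs (i, q) are not coupled, so they can be chosen separately.\<close>

lemma ex_master_feasible_iff:
  assumes det: "determined_part D" and "ng D \<ge> 1" and "Q \<subseteq> Qbar D"
  shows "(\<exists>p l. master_feasible D Q (z, p, l)) \<longleftrightarrow>
         z \<in> Zset D \<and> (\<forall>q\<in>Q. violation D (z, q) \<le> 0)"
proof
  assume "\<exists>p l. master_feasible D Q (z, p, l)"
  then obtain p l where *: "master_feasible D Q (z, p, l)" by blast
  then have z: "z \<in> Zset D" by (simp add: master_feasible_def)
  have "violation D (z, q) \<le> 0" if "q \<in> Q" for q
  proof -
    have "p q = p_of D z q"
      using * that \<open>Q \<subseteq> Qbar D\<close> by (subst p_of_iff[OF det z, symmetric]) (auto simp: master_feasible_def)
    then have "sep_val D i (z, q) \<le> 0" if "i \<in> {1..ng D}" for i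
      using * \<open>q \<in> Q\<close> that by (subst ex_multiplier_iff[symmetric]) (force simp: master_feasible_def)
    then show ?thesis using violation_nonpos_iff[OF \<open>ng D \<ge> 1\<close>] by blast
  qed
  with z show "z \<in> Zset D \<and> (\<forall>q\<in>Q. violation D (z, q) \<le> 0)" by blast
next
  assume *: "z \<in> Zset D \<and> (\<forall>q\<in>Q. violation D (z, q) \<le> 0)"
  then have "\<forall>i q. \<exists>l. i \<in> {1..ng D} \<and> q \<in> Q \<longrightarrow>
      l \<in> unit_simplex (nh D + 1) \<and> multiplier_constraint D i l z (p_of D z q + q)"
    using violation_nonpos_iff[OF \<open>ng D \<ge> 1\<close>] ex_multiplier_iff by metis
  then obtain l where "\<forall>i q. i \<in> {1..ng D} \<and> q \<in> Q \<longrightarrow>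
      l i q \<in> unit_simplex (nh D + 1) \<and> multiplier_constraint D i (l i q) z (p_of D z q + q)"
    by metis
  then have "master_feasible D Q (z, p_of D z, l)"
    using * \<open>Q \<subseteq> Qbar D\<close> p_of_iff[OF det] by (fastforce simp: master_feasible_def)
  then show "\<exists>p l. master_feasible D Q (z, p, l)" by blast
qed

text \<open>A number is below g and all h exactly when it is below their minimum. Thus the
  separation subproblem maximizes \<open>sep_val D i (z, q)\<close> over q.\<close>

lemma separation_feasible_iff:
  assumes det: "determined_part D" and z: "z \<in> Zset D"
  shows "separation_feasible D i z (q, p, s) \<longleftrightarrow>
         q \<in> Qbar D \<and> p = p_of D z q \<and> s \<le> sep_val D i (z, q)"
proof -
  have "s \<le> sep_val D i (z, q) \<longleftrightarrow> s \<le> gfun D i (z, p_of D z q + q) \<and>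
      (\<forall>j\<in>{1..nh D}. s \<le> hfun D j (z, p_of D z q + q))"
    by (auto simp: sep_val_def comp_val_def)
  moreover have "separation_feasible D i z (q, p, s) \<longleftrightarrow> q \<in> Qbar D \<and>
      (p \<in> pspace D \<and> r_zero D z (p + q)) \<and> s \<le> gfun D i (z, p + q) \<and>
      (\<forall>j\<in>{1..nh D}. s \<le> hfun D j (z, p + q))"
    by (auto simp: separation_feasible_def)
  ultimately show ?thesis
    using p_of_iff[OF det z] by metis
qed

text \<open>The master subproblem imposes the constraints of (E) at the points of Q only, so every
  point feasible for (E) extends to a master point.\<close>

lemma master_solution_E_lower_bound:
  assumes det: "determined_part D" and "ng D \<ge> 1" and "Q \<subseteq> Qbar D"
    and sol: "master_solution D Q x"
  shows "fst x \<in> Zset D" "\<And>q. q \<in> Q \<Longrightarrow> violation D (fst x, q) \<le> 0"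
    "\<And>z. E_feasible D z \<Longrightarrow> fobj D (fst x) \<le> fobj D z"
proof -
  have "master_feasible D Q (fst x, fst (snd x), snd (snd x))"
    using sol by (simp add: master_solution_def is_arg_min_def)
  then show "fst x \<in> Zset D" "\<And>q. q \<in> Q \<Longrightarrow> violation D (fst x, q) \<le> 0"
    using ex_master_feasible_iff[OF assms(1-3)] by blast+
  fix z assume "E_feasible D z"
  then obtain p l where "master_feasible D Q (z, p, l)"
    using ex_master_feasible_iff[OF assms(1-3)] E_feasible_iff[OF assms(1,2)] \<open>Q \<subseteq> Qbar D\<close> by blast
  then show "fobj D (fst x) \<le> fobj D z"
    using sol by (fastforce simp: master_solution_def is_arg_min_def case_prod_unfold not_less)
qed

text \<open>The maxima over i and over q commute. For the selected index,
  \<open>snd (snd (S i'))\<close> is at most \<open>sep_val\<close> at its own q, hence at most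
  \<open>violation\<close> there, while it bounds \<open>violation\<close> on all of
  \<open>Qbar D\<close>; so equality holds.\<close>

lemma maximal_separation_solution:
  assumes det: "determined_part D" and z: "z \<in> Zset D"
    and sol: "\<And>i. i \<in> {1..ng D} \<Longrightarrow> separation_solution D i z (S i)"
    and sel: "is_arg_max (\<lambda>i. snd (snd (S i))) (\<lambda>i. i \<in> {1..ng D}) i'"
  shows "fst (S i') \<in> Qbar D" "snd (snd (S i')) = violation D (z, fst (S i'))"
    "\<And>q. q \<in> Qbar D \<Longrightarrow> violation D (z, q) \<le> violation D (z, fst (S i'))"
proof -
  have i': "i' \<in> {1..ng D}" and i'_max: "\<And>i. i \<in> {1..ng D} \<Longrightarrow> snd (snd (S i)) \<le> snd (snd (S i'))"
    using sel by (auto simp: is_arg_max_def not_less)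
  have feas: "separation_feasible D i z (S i)"
    and le: "\<And>y. separation_feasible D i z y \<Longrightarrow> snd (snd y) \<le> snd (snd (S i))"
    if "i \<in> {1..ng D}" for i
    using sol[OF that] by (auto simp: separation_solution_def is_arg_max_def case_prod_unfold not_less)
  have feas': "fst (S i') \<in> Qbar D" "snd (snd (S i')) \<le> sep_val D i' (z, fst (S i'))"
    using feas[OF i'] separation_feasible_iff[OF det z, of i' "fst (S i')" "fst (snd (S i'))" "snd (snd (S i'))"]
    by auto
  then show "fst (S i') \<in> Qbar D" by blast
  have bound: "violation D (z, q) \<le> snd (snd (S i'))" if "q \<in> Qbar D" for q
  proof -
    have "sep_val D i (z, q) \<le> snd (snd (S i'))" if "i \<in> {1..ng D}" for i
      using le[OF that, of "(q, p_of D z q, sep_val D i (z, q))"] i'_max[OF that] \<open>q \<in> Qbar D\<close>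
      by (simp add: separation_feasible_iff[OF det z])
    then show ?thesis
      using i' unfolding violation_def by (subst Max_le_iff) auto
  qed
  moreover have "sep_val D i' (z, fst (S i')) \<le> violation D (z, fst (S i'))"
    using i' unfolding violation_def by (intro Max_ge) auto
  ultimately show eq: "snd (snd (S i')) = violation D (z, fst (S i'))"
    using feas' by force
  show "\<And>q. q \<in> Qbar D \<Longrightarrow> violation D (z, q) \<le> violation D (z, fst (S i'))"
    using bound eq by simp
qed

section \<open>Runs of the algorithm\<close>

theorem theorem2:
  fixes D :: "('z::finite, 'v::finite) problem"
    and \<rho> :: enat
    and A :: "('z, 'v) solvers"
    and Q0 :: "(real ^ 'v) set"
  assumes "bounded (Vbar D)"
    and "compactness D"
    and "determined_part D"
    and "smoothness \<rho> D"
    and "\<exists>z. E_feasible D z"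
    and "finite Q0" and "Q0 \<noteq> {}" and "Q0 \<subseteq> Qbar D"
    and "solved_to_optimality D A Q0"
    and "selects_maximal D A Q0"
  shows "(\<exists>z. terminates_with A Q0 z \<and> E_solution D z) \<or>
         (\<exists>zs. generates_sequence A Q0 zs \<and>
            (\<forall>x. accumulation_point zs x \<longrightarrow> E_solution D x))"
proof -
  note det = \<open>determined_part D\<close>
  have run_0: "run A Q0 0 = Running (card Q0) Q0"
    by (simp add: run_def)
  have run_Suc: "run A Q0 (Suc k) = step A (run A Q0 k)" for k
    by (simp add: run_def)
  \<comment> \<open>The index selected in the first pass belongs to
    \<open>{1..ng D}\<close>.\<close>
  have "ng D \<ge> 1"
    using \<open>selects_maximal D A Q0\<close> run_0 by (fastforce simp: selects_maximal_def is_arg_max_def)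
  define S where "S m Q = separation A m (selection A m) (master_z A m Q)" for m Q
  have step_Running: "step A (Running m Q) =
      (if snd (snd (S m Q)) \<le> 0 then Stopped (master_z A m Q) else Running (m + 1) (insert (fst (S m Q)) Q))"
    for m Q
    by (simp add: S_def Let_def case_prod_unfold)
  have master: "master_solution D Q (master A m Q)" if "run A Q0 k = Running m Q" for k m Q
    using \<open>solved_to_optimality D A Q0\<close> that by (auto simp: solved_to_optimality_def)
  have sep: "separation_solution D i (master_z A m Q) (separation A m i (master_z A m Q))"
    if "run A Q0 k = Running m Q" "i \<in> {1..ng D}" for k m Q i
    using \<open>solved_to_optimality D A Q0\<close> that by (auto simp: solved_to_optimality_def)
  have sel: "is_arg_max (\<lambda>i. snd (snd (separation A m i (master_z A m Q)))) (\<lambda>i. i \<in> {1..ng D})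
      (selection A m)" if "run A Q0 k = Running m Q" for k m Q
    using \<open>selects_maximal D A Q0\<close> that by (auto simp: selects_maximal_def)
  \<comment> \<open>Optimality of the separation answer places the new point in
    \<open>Qbar D\<close>, but only for a master solution in \<open>Zset D\<close>, which in turn
    uses the inclusion for the previous set.\<close>
  have sub: "Q \<subseteq> Qbar D" if "run A Q0 k = Running m Q" for k m Q
    using that
  proof (induction k arbitrary: m Q)
    case 0
    then show ?case using run_0 \<open>Q0 \<subseteq> Qbar D\<close> by simp
  next
    case (Suc k)
    then obtain m' Q' where prev: "run A Q0 k = Running m' Q'"
      by (cases "run A Q0 k") (auto simp: run_Suc)
    have z: "master_z A m' Q' \<in> Zset D"
      using master_solution_E_lower_bound(1)[OF det \<open>ng D \<ge> 1\<close> Suc.IH[OF prev] master[OF prev]]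
      by (simp add: master_z_def)
    have "Q = insert (fst (S m' Q')) Q'"
      using Suc.prems prev by (auto simp: run_Suc step_Running simp del: step.simps split: if_splits)
    with Suc.IH[OF prev] show ?case
      using maximal_separation_solution(1)[OF det z sep[OF prev] sel[OF prev]] by (simp add: S_def)
  qed
  \<comment> \<open>\<open>sub\<close> and \<open>master\<close> each consume the fact that the
    state is running, so later uses supply it twice.\<close>
  note relax = master_solution_E_lower_bound[OF det \<open>ng D \<ge> 1\<close> sub master, folded master_z_def]
  have cuts: "fst (S m Q) \<in> Qbar D"
      "snd (snd (S m Q)) = violation D (master_z A m Q, fst (S m Q))"
      "\<And>q. q \<in> Qbar D \<Longrightarrow>
        violation D (master_z A m Q, q) \<le> violation D (master_z A m Q, fst (S m Q))"
    if "run A Q0 k = Running m Q" for k m Q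
    using maximal_separation_solution[OF det relax(1)[OF that that] sep[OF that] sel[OF that]]
    by (simp_all add: S_def)
  show ?thesis
  proof (cases "\<exists>k z. run A Q0 k = Stopped z")
    case True
    \<comment> \<open>A stopped state persists and keeps only z. The first one is preceded by a
      running state, which reveals the subproblems that produced z.\<close>
    define k where "k = (LEAST k. \<exists>z. run A Q0 k = Stopped z)"
    obtain z where z: "run A Q0 k = Stopped z"
      using LeastI_ex[OF True] unfolding k_def by blast
    then obtain k' where k': "k = Suc k'"
      using run_0 by (cases k) auto
    have "\<nexists>z. run A Q0 k' = Stopped z"
      using not_less_Least[of k' "\<lambda>k. \<exists>z. run A Q0 k = Stopped z"] k' by (simp add: k_def)
    then obtain m Q where run: "run A Q0 k' = Running m Q"
      by (cases "run A Q0 k'") auto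
    have zz: "z = master_z A m Q" "snd (snd (S m Q)) \<le> 0"
      using z run by (auto simp: k' run_Suc step_Running simp del: step.simps split: if_splits)
    \<comment> \<open>The value tested for stopping is the maximum of
      \<open>violation D (z, q)\<close> over \<open>Qbar D\<close>.\<close>
    then have "\<forall>q\<in>Qbar D. violation D (z, q) \<le> 0"
      using cuts(2,3)[OF run] by fastforce
    then have "E_feasible D z"
      using E_feasible_iff[OF det \<open>ng D \<ge> 1\<close>] relax(1)[OF run run] zz by blast
    then have "E_solution D z"
      using relax(3)[OF run run] zz by (auto simp: E_solution_def is_arg_min_def not_less)
    then show ?thesis
      using z by (auto simp: terminates_with_def)
  next
    case False
    then have "\<forall>k. \<exists>m Q. run A Q0 k = Running m Q"
      by (metis state.exhaust)
    then obtain ms Qs where run: "\<And>k. run A Q0 k = Running (ms k) (Qs k)"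
      by metis
    define zs where "zs k = master_z A (ms k) (Qs k)" for k
    define qs where "qs k = fst (S (ms k) (Qs k))" for k
    note relax' = relax[OF run run, folded zs_def]
    note cuts' = cuts[OF run, folded zs_def qs_def]
    have Qs_Suc: "Qs (Suc k) = insert (qs k) (Qs k)" for k
      using run_Suc[of k] by (auto simp: run step_Running qs_def simp del: step.simps split: if_splits)
    \<comment> \<open>Points are never removed, so every later master solution satisfies all earlier
      cuts.\<close>
    have "qs k \<in> Qs l" if "k < l" for k l
      using that by (induction l) (auto simp: Qs_Suc less_Suc_eq)
    then have cut: "violation D (zs l, qs k) \<le> 0" if "k < l" for k l
      using relax'(2) that by blast
    have compact: "compact (Zset D)" "compact (Qbar D)"
      using \<open>compactness D\<close> det by (auto simp: compactness_def determined_part_def)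
    have cont: "continuous_on (Zset D \<times> Qbar D) (violation D)"
      unfolding violation_def using \<open>ng D \<ge> 1\<close>
      by (intro continuous_on_Max_image continuous_on_sep_val[OF det \<open>smoothness \<rho> D\<close>]) auto
    have "E_solution D x" if x: "accumulation_point zs x" for x
    proof -
      obtain \<phi> :: "nat \<Rightarrow> nat" where \<phi>: "(\<lambda>n. zs (\<phi> n)) \<longlonglongrightarrow> x"
        using x by (auto simp: accumulation_point_def o_def)
      have "x \<in> Zset D"
        using compact_imp_closed[OF compact(1)] \<phi> relax'(1) by (meson closed_sequentially)
      moreover have "violation D (x, q) \<le> 0" if "q \<in> Qbar D" for q
        using accumulation_point_cutting_set[OF compact cont relax'(1) cuts'(1) cuts'(3) cut x that] .
      ultimately have "E_feasible D x"
        using E_feasible_iff[OF det \<open>ng D \<ge> 1\<close>] by blast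
      have f: "continuous_on (Zset D) (fobj D)"
        using \<open>smoothness \<rho> D\<close> by (auto simp: smoothness_def intro: C_class_imp_continuous_on)
      have "(\<lambda>n. fobj D (zs (\<phi> n))) \<longlonglongrightarrow> fobj D x"
        using continuous_on_tendsto_compose[OF f \<phi> \<open>x \<in> Zset D\<close>] relax'(1) by simp
      \<comment> \<open>Each iterate already has objective value at most \<open>fobj D z\<close>,
        and the bound passes to the limit.\<close>
      then have "fobj D x \<le> fobj D z" if "E_feasible D z" for z
        by (rule LIMSEQ_le_const2) (use relax'(3) that in blast)
      with \<open>E_feasible D x\<close> show ?thesis
        by (auto simp: E_solution_def is_arg_min_def not_less)
    qed
    moreover have "generates_sequence A Q0 zs"
      using run by (auto simp: generates_sequence_def zs_def)
    ultimately show ?thesis by blast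
  qed
qed

end
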